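(* Let $a_n=|B_n(231,312,321)|$. Then $a_1=a_2=1$ and $a_n=a_{n-1}+a_{n-2}$ for all $n\ge 3$; that is, $a_n$ is the $n$-th Fibonacci number.
   Context: A permutation $\sigma\in S_n$ is written as $\sigma(1)\cdots\sigma(n)$. An index $i\in[n-1]$ is an ascent if $\sigma(i)<\sigma(i+1)$ and a descent if $\sigma(i)>\sigma(i+1)$. A ballot permutation is a permutation such that every prefix $\sigma(1)\cdots\sigma(p)$ has at least as many ascents as descents. $\sigma$ contains a pattern $\pi\in S_k$ if some subsequence $\sigma(c_1)\cdots\sigma(c_k)$ with $c_1<\dots<c_k$ is order-isomorphic to $\pi$, and avoids $\pi$ otherwise. $B_n(\pi_1,\dots,\pi_m)$ denotes the set of ballot permutations of length $n$ avoiding all of $\pi_1,\dots,\pi_m$. *)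

theory Defs
  imports
    "HOL-Combinatorics.Multiset_Permutations"
    "HOL-Library.Sublist"
    "HOL-Number_Theory.Fib"
begin

text \<open>
  A permutation in $S_n$ is given by its one-line notation, i.e. as an element of
  \<^term>\<open>permutations_of_set {1..n}\<close>. The letter $\sigma(i)$ of a word is the list entry
  \<^term>\<open>\<sigma> ! (i - 1)\<close>; ascents and descents keep the 1-based positions $i \in [n-1]$.
\<close>

definition ascents :: "nat list \<Rightarrow> nat set" where
  "ascents \<sigma> = {i \<in> {1..<length \<sigma>}. \<sigma> ! (i - 1) < \<sigma> ! i}"

definition descents :: "nat list \<Rightarrow> nat set" where
  "descents \<sigma> = {i \<in> {1..<length \<sigma>}. \<sigma> ! (i - 1) > \<sigma> ! i}"

definition ballot :: "nat list \<Rightarrow> bool" where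
  "ballot \<sigma> \<longleftrightarrow> (\<forall>\<tau>. prefix \<tau> \<sigma> \<longrightarrow> card (ascents \<tau>) \<ge> card (descents \<tau>))"

definition order_isomorphic :: "nat list \<Rightarrow> nat list \<Rightarrow> bool" where
  "order_isomorphic \<tau> \<pi> \<longleftrightarrow> length \<tau> = length \<pi> \<and>
     (\<forall>i < length \<pi>. \<forall>j < length \<pi>. \<tau> ! i < \<tau> ! j \<longleftrightarrow> \<pi> ! i < \<pi> ! j)"

definition contains_pattern :: "nat list \<Rightarrow> nat list \<Rightarrow> bool" where
  "contains_pattern \<sigma> \<pi> \<longleftrightarrow> (\<exists>\<tau>. subseq \<tau> \<sigma> \<and> order_isomorphic \<tau> \<pi>)"

definition ballot_avoiding :: "nat \<Rightarrow> nat list set \<Rightarrow> nat list set" where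
  "ballot_avoiding n P =
     {\<sigma> \<in> permutations_of_set {1..n}. ballot \<sigma> \<and> (\<forall>\<pi>\<in>P. \<not> contains_pattern \<sigma> \<pi>)}"

end

theory Submission
  imports Defs
begin

text \<open>
  The three patterns are exactly the \<open>abc \<in> S\<^sub>3\<close> with \<open>a > c\<close>, so they are all avoided iff
  any two letters at distance at least two appear in increasing order. Hence the last letter of an
  avoiding permutation of \<open>[n]\<close> is \<open>n\<close>, or the last two are \<open>n (n - 1)\<close>. Appending \<open>n\<close> adds an
  ascent and appending \<open>n (n - 1)\<close> adds an ascent followed by a descent, so both operations preserve
  and reflect the ballot property of a nonempty word; this gives the Fibonacci recurrence.
\<close>

section \<open>Avoidance of the three patterns as a condition on distant letters\<close>

lemma subseq_snoc_iff:
  "subseq (xs @ [c]) (ys @ [x]) \<longleftrightarrow> subseq (xs @ [c]) ys \<or> c = x \<and> subseq xs ys"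
proof
  assume "subseq (xs @ [c]) (ys @ [x])"
  then obtain us vs where split: "xs @ [c] = us @ vs" "subseq us ys" "subseq vs [x]"
    by (auto simp: subseq_append_iff)
  show "subseq (xs @ [c]) ys \<or> c = x \<and> subseq xs ys"
  proof (cases vs)
    case Nil
    with split show ?thesis by simp
  next
    case (Cons v ws)
    with split(3) have "vs = [x]" by (auto simp: subseq_Cons2_iff split: if_splits)
    with split show ?thesis by simp
  qed
qed (auto intro: subseq_rev_drop_many)

lemma order_isomorphic_triple_iff:
  "order_isomorphic \<tau> [p, q, r] \<longleftrightarrow> (\<exists>a b c. \<tau> = [a, b, c] \<and>
     (a < b \<longleftrightarrow> p < q) \<and> (b < a \<longleftrightarrow> q < p) \<and> (a < c \<longleftrightarrow> p < r) \<and>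
     (c < a \<longleftrightarrow> r < p) \<and> (b < c \<longleftrightarrow> q < r) \<and> (c < b \<longleftrightarrow> r < q))"
proof (cases "\<exists>a b c. \<tau> = [a, b, c]")
  case True
  then show ?thesis
    by (elim exE) (simp add: order_isomorphic_def All_less_Suc, blast)
next
  case False
  then have "length \<tau> \<noteq> 3"
    by (auto simp: numeral_3_eq_3 length_Suc_conv)
  with False show ?thesis
    by (auto simp: order_isomorphic_def)
qed

lemma subseq_distinct: "subseq xs ys \<Longrightarrow> distinct ys \<Longrightarrow> distinct xs"
  by (auto simp: subseq_conv_nths distinct_nthsI)

text \<open>The middle letter \<open>b\<close> only witnesses that \<open>a\<close> and
  \<open>c\<close> are not adjacent. Expressing distance through \<open>subseq\<close> avoids
  indices and matches the form of \<open>contains_pattern\<close>.\<close>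

definition far_increasing :: "nat list \<Rightarrow> bool" where
  "far_increasing \<sigma> \<longleftrightarrow> (\<forall>a b c. subseq [a, b, c] \<sigma> \<longrightarrow> a < c)"

text \<open>If \<open>a > c\<close>, the size of \<open>b\<close> decides the pattern: above both
  gives 231, below both 312, between them 321. Distinctness excludes ties.\<close>

lemma avoids_iff_far_increasing:
  assumes "distinct \<sigma>"
  shows "(\<forall>\<pi>\<in>{[2,3,1], [3,1,2], [3,2,1]}. \<not> contains_pattern \<sigma> \<pi>) \<longleftrightarrow> far_increasing \<sigma>"
proof -
  have iso: "order_isomorphic \<tau> [2,3,1] \<longleftrightarrow> (\<exists>a b c. \<tau> = [a, b, c] \<and> c < a \<and> a < b)"
    "order_isomorphic \<tau> [3,1,2] \<longleftrightarrow> (\<exists>a b c. \<tau> = [a, b, c] \<and> b < c \<and> c < a)"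
    "order_isomorphic \<tau> [3,2,1] \<longleftrightarrow> (\<exists>a b c. \<tau> = [a, b, c] \<and> c < b \<and> b < a)" for \<tau>
    unfolding order_isomorphic_triple_iff by (intro ex_cong1; force)+
  have "a \<noteq> b \<and> b \<noteq> c \<and> a \<noteq> c" if "subseq [a, b, c] \<sigma>" for a b c
    using subseq_distinct[OF that assms] by auto
  then have "\<not> a < c \<longleftrightarrow> c < a \<and> a < b \<or> b < c \<and> c < a \<or> c < b \<and> b < a"
    if "subseq [a, b, c] \<sigma>" for a b c
    using that by (metis less_asym less_trans linorder_neqE_nat)
  then have "far_increasing \<sigma> \<longleftrightarrow> (\<forall>a b c. subseq [a, b, c] \<sigma> \<longrightarrow>
      \<not> (c < a \<and> a < b) \<and> \<not> (b < c \<and> c < a) \<and> \<not> (c < b \<and> b < a))"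
    unfolding far_increasing_def by metis
  also have "\<dots> \<longleftrightarrow> (\<forall>\<pi>\<in>{[2,3,1], [3,1,2], [3,2,1]}. \<not> contains_pattern \<sigma> \<pi>)"
    by (simp add: contains_pattern_def iso del: One_nat_def) blast
  finally show ?thesis ..
qed

lemma far_increasing_singleton: "far_increasing [x]"
  by (auto simp: far_increasing_def dest: list_emb_length)

text \<open>A new three-letter subsequence ends in the appended \<open>x\<close>. As the final
  \<open>y\<close> can be its middle letter but not its first, the possible first letters are
  exactly those of \<tau>; the order of \<open>y\<close> and \<open>x\<close> stays free.\<close>

lemma far_increasing_snoc2:
  "far_increasing (\<tau> @ [y, x]) \<longleftrightarrow> far_increasing (\<tau> @ [y]) \<and> (\<forall>a\<in>set \<tau>. a < x)"
proof -
  have split3: "subseq [a, b, c] (\<tau> @ [y, x]) \<longleftrightarrow>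
      subseq [a, b, c] (\<tau> @ [y]) \<or> c = x \<and> subseq [a, b] (\<tau> @ [y])" for a b c
    using subseq_snoc_iff[of "[a, b]" c "\<tau> @ [y]" x] by simp
  have split2: "subseq [a, b] (\<tau> @ [y]) \<longleftrightarrow> subseq [a, b] \<tau> \<or> b = y \<and> a \<in> set \<tau>" for a b
    using subseq_snoc_iff[of "[a]" b \<tau> y] by (simp add: subseq_singleton_left)
  have "a \<in> set \<tau>" if "subseq [a, b] \<tau>" for a b
    using that by (auto elim: list_emb_set)
  with split2 have pair: "(\<exists>b. subseq [a, b] (\<tau> @ [y])) \<longleftrightarrow> a \<in> set \<tau>" for a
    by blast
  have "far_increasing (\<tau> @ [y, x]) \<longleftrightarrow>
      far_increasing (\<tau> @ [y]) \<and> (\<forall>a. (\<exists>b. subseq [a, b] (\<tau> @ [y])) \<longrightarrow> a < x)"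
    unfolding far_increasing_def split3 by blast
  then show ?thesis
    by (simp only: pair Ball_def)
qed

section \<open>Ascents, descents and the ballot property under appending letters\<close>

lemma ascents_Nil [simp]: "ascents [] = {}"
  and descents_Nil [simp]: "descents [] = {}"
  and ascents_singleton [simp]: "ascents [z] = {}"
  and descents_singleton [simp]: "descents [z] = {}"
  by (auto simp: ascents_def descents_def)

lemma finite_ascents [simp]: "finite (ascents \<sigma>)"
  and finite_descents [simp]: "finite (descents \<sigma>)"
  by (simp_all add: ascents_def descents_def)

lemma nth_snoc2:
  "i \<le> length \<tau> \<Longrightarrow> (\<tau> @ [y, x]) ! i = (\<tau> @ [y]) ! i"
  "(\<tau> @ [y, x]) ! Suc (length \<tau>) = x"
  using nth_append_left[of i "\<tau> @ [y]" "[x]"] nth_append_length[of "\<tau> @ [y]" x] by simp_all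

text \<open>Two final letters are made explicit because the only new position,
  \<open>Suc (length \<tau>)\<close> in 1-based counting, compares exactly these.\<close>

lemma ascents_snoc2:
  "ascents (\<tau> @ [y, x]) = ascents (\<tau> @ [y]) \<union> (if y < x then {Suc (length \<tau>)} else {})"
proof -
  have "i \<in> ascents (\<tau> @ [y, x]) \<longleftrightarrow> i \<in> ascents (\<tau> @ [y]) \<or> i = Suc (length \<tau>) \<and> y < x" for i
    by (cases i "Suc (length \<tau>)" rule: linorder_cases) (simp_all add: ascents_def nth_snoc2)
  then show ?thesis by auto
qed

lemma descents_snoc2:
  "descents (\<tau> @ [y, x]) = descents (\<tau> @ [y]) \<union> (if x < y then {Suc (length \<tau>)} else {})"
proof -
  have "i \<in> descents (\<tau> @ [y, x]) \<longleftrightarrow> i \<in> descents (\<tau> @ [y]) \<or> i = Suc (length \<tau>) \<and> x < y" for i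
    by (cases i "Suc (length \<tau>)" rule: linorder_cases) (simp_all add: descents_def nth_snoc2)
  then show ?thesis by auto
qed

lemma card_ascents_snoc2:
  "card (ascents (\<tau> @ [y, x])) = card (ascents (\<tau> @ [y])) + (if y < x then 1 else 0)"
proof -
  have "Suc (length \<tau>) \<notin> ascents (\<tau> @ [y])" by (simp add: ascents_def)
  then show ?thesis by (simp add: ascents_snoc2)
qed

lemma card_descents_snoc2:
  "card (descents (\<tau> @ [y, x])) = card (descents (\<tau> @ [y])) + (if x < y then 1 else 0)"
proof -
  have "Suc (length \<tau>) \<notin> descents (\<tau> @ [y])" by (simp add: descents_def)
  then show ?thesis by (simp add: descents_snoc2)
qed

text \<open>The only prefix that is not already a prefix of \<tau> is the whole word.\<close>

lemma ballot_snoc: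
  "ballot (\<tau> @ [x]) \<longleftrightarrow> ballot \<tau> \<and> card (descents (\<tau> @ [x])) \<le> card (ascents (\<tau> @ [x]))"
  by (auto simp: ballot_def)

lemma ballot_card: "ballot \<tau> \<Longrightarrow> card (descents \<tau>) \<le> card (ascents \<tau>)"
  by (simp add: ballot_def)

lemma ballot_singleton: "ballot [x]"
  by (auto simp: ballot_def prefix_Cons)

lemma ballot_snoc_ascent:
  assumes "y < x"
  shows "ballot (\<tau> @ [y, x]) \<longleftrightarrow> ballot (\<tau> @ [y])"
  using assms ballot_snoc[of "\<tau> @ [y]" x] ballot_card[of "\<tau> @ [y]"]
  by (auto simp: card_ascents_snoc2 card_descents_snoc2)

text \<open>The ascent from \<open>z\<close> to \<open>y\<close> pays for the descent from
  \<open>y\<close> to \<open>x\<close>: the whole word has the same surplus of ascents as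
  \<open>\<tau> @ [z]\<close>.\<close>

lemma ballot_snoc_ascent_descent:
  assumes "z < y" "x < y"
  shows "ballot (\<tau> @ [z, y, x]) \<longleftrightarrow> ballot (\<tau> @ [z])"
  using assms ballot_snoc[of "\<tau> @ [z, y]" x] ballot_card[of "\<tau> @ [z]"]
    ballot_snoc_ascent[of z y \<tau>]
    card_ascents_snoc2[of "\<tau> @ [z]" y x] card_descents_snoc2[of "\<tau> @ [z]" y x]
  by (auto simp: card_ascents_snoc2 card_descents_snoc2)

text \<open>This excludes 21 in the base case of length two, where no letter precedes the descent to
  form an ascent.\<close>

lemma not_ballot_descent: "x < y \<Longrightarrow> \<not> ballot [y, x]"
  using ballot_card[of "[y, x]"] card_ascents_snoc2[of "[]" y x] card_descents_snoc2[of "[]" y x]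
  by auto

section \<open>The counted class and its decomposition by last letters\<close>

definition fib_class :: "nat \<Rightarrow> nat list set" where
  "fib_class n = ballot_avoiding n {[2,3,1], [3,1,2], [3,2,1]}"

lemma fib_class_iff:
  "\<sigma> \<in> fib_class n \<longleftrightarrow> distinct \<sigma> \<and> set \<sigma> = {1..n} \<and> ballot \<sigma> \<and> far_increasing \<sigma>"
  using avoids_iff_far_increasing[of \<sigma>]
  unfolding fib_class_def ballot_avoiding_def permutations_of_set_def by blast

lemma finite_fib_class: "finite (fib_class n)"
  by (simp add: fib_class_def ballot_avoiding_def)

lemma fib_class_1: "fib_class 1 = {[1]}"
proof -
  have "\<sigma> = [1]" if "distinct \<sigma>" "set \<sigma> = {1}" for \<sigma> :: "nat list"
    using that by (cases \<sigma>; cases "tl \<sigma>") auto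
  then show ?thesis
    by (auto simp: fib_class_iff ballot_singleton far_increasing_singleton)
qed

text \<open>If \<tau> already contains \<open>Suc n\<close>, both sides fail; otherwise
  \<open>Suc n\<close> can be cancelled from both sets.\<close>

lemma perm_snoc_max:
  "distinct (\<tau> @ [Suc n]) \<and> set (\<tau> @ [Suc n]) = {1..Suc n} \<longleftrightarrow> distinct \<tau> \<and> set \<tau> = {1..n}"
proof (cases "Suc n \<in> set \<tau>")
  case False
  moreover have "{1..Suc n} = insert (Suc n) {1..n}" by auto
  ultimately show ?thesis
    using insert_ident[of "Suc n" "set \<tau>" "{1..n}"] by simp
qed auto

lemma fib_class_snoc_max:
  assumes "n \<ge> 1"
  shows "\<tau> @ [Suc n] \<in> fib_class (Suc n) \<longleftrightarrow> \<tau> \<in> fib_class n"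
proof -
  note set = perm_snoc_max[of \<tau> n]
  show ?thesis
  proof (cases "distinct \<tau> \<and> set \<tau> = {1..n}")
    case True
    then have less: "\<forall>a\<in>set \<tau>. a < Suc n" by simp
    \<comment> \<open>A last letter \<open>z\<close> of \<tau> is needed to see that appending
      \<open>Suc n\<close> creates an ascent.\<close>
    have "\<tau> \<noteq> []" using True assms by auto
    then obtain \<rho> z where snoc: "\<tau> = \<rho> @ [z]"
      by (meson rev_exhaust)
    then have z: "z < Suc n" "\<forall>a\<in>set \<rho>. a < Suc n"
      using less by simp_all
    have "ballot (\<tau> @ [Suc n]) \<longleftrightarrow> ballot \<tau>"
      using z by (simp add: snoc ballot_snoc_ascent)
    moreover have "far_increasing (\<tau> @ [Suc n]) \<longleftrightarrow> far_increasing \<tau>"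
      using z by (simp add: snoc far_increasing_snoc2)
    ultimately show ?thesis
      using set unfolding fib_class_iff by blast
  next
    case False
    with set show ?thesis unfolding fib_class_iff by blast
  qed
qed

text \<open>Distinctness and the set of letters ignore order, so the two letters may be exchanged
  and the maximum split off twice.\<close>

lemma perm_snoc_swap:
  "distinct (\<tau> @ [Suc (Suc n), Suc n]) \<and>
     set (\<tau> @ [Suc (Suc n), Suc n]) = {1..Suc (Suc n)} \<longleftrightarrow>
   distinct \<tau> \<and> set \<tau> = {1..n}"
proof -
  have "distinct (\<tau> @ [Suc (Suc n), Suc n]) \<longleftrightarrow> distinct ((\<tau> @ [Suc n]) @ [Suc (Suc n)])"
    "set (\<tau> @ [Suc (Suc n), Suc n]) = set ((\<tau> @ [Suc n]) @ [Suc (Suc n)])"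
    by auto
  then show ?thesis
    by (simp only: perm_snoc_max)
qed

lemma fib_class_snoc_swap:
  assumes "n \<ge> 1"
  shows "\<tau> @ [Suc (Suc n), Suc n] \<in> fib_class (Suc (Suc n)) \<longleftrightarrow> \<tau> \<in> fib_class n"
proof -
  note set = perm_snoc_swap[of \<tau> n]
  show ?thesis
  proof (cases "distinct \<tau> \<and> set \<tau> = {1..n}")
    case True
    then have less: "\<forall>a\<in>set \<tau>. a < Suc n" by simp
    \<comment> \<open>Here \<open>n \<ge> 1\<close> is essential: the empty word is ballot, but 21
      is not.\<close>
    have "\<tau> \<noteq> []" using True assms by auto
    then obtain \<rho> z where snoc: "\<tau> = \<rho> @ [z]"
      by (meson rev_exhaust)
    then have z: "z < Suc n" "\<forall>a\<in>set \<rho>. a < Suc n"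
      using less by simp_all
    have "ballot (\<tau> @ [Suc (Suc n), Suc n]) \<longleftrightarrow> ballot \<tau>"
      using z by (simp add: snoc ballot_snoc_ascent_descent)
    \<comment> \<open>The final \<open>Suc n\<close> has to exceed only the letters of \<tau>, not
      its larger neighbour.\<close>
    moreover have "far_increasing (\<tau> @ [Suc (Suc n), Suc n]) \<longleftrightarrow> far_increasing \<tau>"
      using less z far_increasing_snoc2[of \<tau> "Suc (Suc n)" "Suc n"]
        far_increasing_snoc2[of \<rho> z "Suc (Suc n)"]
      by (simp add: snoc less_SucI)
    ultimately show ?thesis
      using set unfolding fib_class_iff by blast
  next
    case False
    with set show ?thesis unfolding fib_class_iff by blast
  qed
qed

text \<open>The last letter exceeds all letters but its neighbour \<open>y\<close>, so the maximum
  is one of these two. If it is \<open>y\<close>, the second largest letter must be last.\<close>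

lemma fib_class_last:
  assumes "\<sigma> \<in> fib_class (Suc (Suc n))"
  shows "\<exists>\<tau>. \<sigma> = \<tau> @ [Suc (Suc n)] \<or> \<sigma> = \<tau> @ [Suc (Suc n), Suc n]"
proof -
  have \<sigma>: "distinct \<sigma>" "set \<sigma> = {1..Suc (Suc n)}" "far_increasing \<sigma>"
    using assms by (auto simp: fib_class_iff)
  then have "length \<sigma> = Suc (Suc n)"
    using distinct_card by fastforce
  then obtain \<tau> y x where split: "\<sigma> = \<tau> @ [y, x]"
    by (cases \<sigma> rule: rev_cases; cases "butlast \<sigma>" rule: rev_cases) auto
  have less: "\<forall>a\<in>set \<tau>. a < x"
    using \<sigma>(3) by (simp add: split far_increasing_snoc2)
  have sub: "x \<le> Suc (Suc n)" "y \<noteq> x"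
    using \<sigma>(1,2) split by auto
  have "Suc (Suc n) \<in> set \<sigma>" "Suc n \<in> set \<sigma>"
    using \<sigma>(2) by auto
  moreover have "Suc (Suc n) \<notin> set \<tau>"
    using less sub by fastforce
  \<comment> \<open>A letter \<open>Suc n\<close> inside \<tau> leaves only the maximum as a value
    for \<open>x\<close>.\<close>
  moreover have "x = Suc (Suc n)" if "Suc n \<in> set \<tau>"
    using less sub that by (meson Suc_leI le_antisym)
  ultimately have "x = Suc (Suc n) \<or> y = Suc (Suc n) \<and> x = Suc n"
    by (auto simp: split)
  then show ?thesis
    using split by auto
qed

lemma fib_class_rec:
  assumes "n \<ge> 1"
  shows "fib_class (Suc (Suc n)) =
    (\<lambda>\<tau>. \<tau> @ [Suc (Suc n)]) ` fib_class (Suc n) \<union> (\<lambda>\<tau>. \<tau> @ [Suc (Suc n), Suc n]) ` fib_class n"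
  (is "?L = ?R")
proof (rule set_eqI)
  fix \<sigma>
  \<comment> \<open>Exposing the possible endings of \<sigma> makes the two appending equivalences
    applicable under the quantifier.\<close>
  have "\<sigma> \<in> ?L \<longleftrightarrow> (\<exists>\<tau>. \<sigma> = \<tau> @ [Suc (Suc n)] \<and> \<sigma> \<in> ?L \<or> \<sigma> = \<tau> @ [Suc (Suc n), Suc n] \<and> \<sigma> \<in> ?L)"
    using fib_class_last by blast
  also have "\<dots> \<longleftrightarrow> (\<exists>\<tau>. \<sigma> = \<tau> @ [Suc (Suc n)] \<and> \<tau> \<in> fib_class (Suc n) \<or>
      \<sigma> = \<tau> @ [Suc (Suc n), Suc n] \<and> \<tau> \<in> fib_class n)"
    using fib_class_snoc_max[of "Suc n"] fib_class_snoc_swap[OF assms] by (intro ex_cong1) auto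
  also have "\<dots> \<longleftrightarrow> \<sigma> \<in> ?R"
    by (simp only: Un_iff image_iff Bex_def ex_disj_distrib conj_commute)
  finally show "\<sigma> \<in> ?L \<longleftrightarrow> \<sigma> \<in> ?R" .
qed

section \<open>Counting and the Fibonacci numbers\<close>

lemma card_fib_class_rec:
  assumes "n \<ge> 1"
  shows "card (fib_class (Suc (Suc n))) = card (fib_class (Suc n)) + card (fib_class n)"
proof -
  have "\<tau> @ [Suc (Suc n)] \<noteq> \<rho> @ [Suc (Suc n), Suc n]" for \<tau> \<rho>
    using arg_cong[of "\<tau> @ [Suc (Suc n)]" "\<rho> @ [Suc (Suc n), Suc n]" last] by auto
  then have "(\<lambda>\<tau>. \<tau> @ [Suc (Suc n)]) ` fib_class (Suc n) \<inter>
      (\<lambda>\<tau>. \<tau> @ [Suc (Suc n), Suc n]) ` fib_class n = {}"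
    by blast
  then show ?thesis
    unfolding fib_class_rec[OF assms]
    by (simp add: card_Un_disjoint finite_fib_class card_image inj_on_def)
qed

text \<open>The recurrence begins at length three, so length two is a separate base case.\<close>

lemma fib_class_2: "fib_class 2 = {[1, 2]}"
proof -
  have "\<sigma> = [1, 2]" if mem: "\<sigma> \<in> fib_class 2" for \<sigma>
  proof -
    obtain \<tau> where "\<sigma> = \<tau> @ [2] \<or> \<sigma> = \<tau> @ [2, 1]"
      using fib_class_last[of \<sigma> 0] mem by (auto simp: numeral_2_eq_2)
    then show ?thesis
    proof
      assume \<sigma>: "\<sigma> = \<tau> @ [2]"
      then have "\<tau> \<in> fib_class 1"
        using mem fib_class_snoc_max[of 1 \<tau>] by (simp add: numeral_2_eq_2)
      then show ?thesis
        using \<sigma> fib_class_1 by simp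
    next
      assume \<sigma>: "\<sigma> = \<tau> @ [2, 1]"
      \<comment> \<open>The length forces \<tau> to be empty, so \<sigma> is the non-ballot word
        21.\<close>
      have "length \<sigma> = 2"
        using mem distinct_card[of \<sigma>] by (simp add: fib_class_iff)
      with \<sigma> mem show ?thesis
        using not_ballot_descent[of 1 2] by (simp add: fib_class_iff)
    qed
  qed
  moreover have "[1, 2] \<in> fib_class 2"
    using fib_class_snoc_max[of 1 "[1]"] fib_class_1 by (simp add: numeral_2_eq_2)
  ultimately show ?thesis by blast
qed

text \<open>The index is shifted because length 0 disagrees: the empty word is counted, but
  \<open>fib 0 = 0\<close>.\<close>

lemma card_fib_class: "card (fib_class (Suc n)) = fib (Suc n)"
proof (induction n rule: fib.induct)
  case 1
  then show ?case using fib_class_1 by simp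
next
  case 2
  then show ?case using fib_class_2 by (simp add: numeral_2_eq_2)
next
  case (3 n)
  then show ?case using card_fib_class_rec[of "Suc n"] by simp
qed

theorem theorem4p8:
  fixes a :: "nat \<Rightarrow> nat"
  assumes a_def: "\<And>n. a n = card (ballot_avoiding n {[2,3,1], [3,1,2], [3,2,1]})"
  shows "a 1 = 1 \<and> a 2 = 1 \<and> (\<forall>n\<ge>3. a n = a (n - 1) + a (n - 2)) \<and> (\<forall>n\<ge>1. a n = fib n)"
proof -
  have fib: "a n = fib n" if "n \<ge> 1" for n
    using that card_fib_class[of "n - 1"] by (simp only: a_def flip: fib_class_def) simp
  have "a n = a (n - 1) + a (n - 2)" if n: "n \<ge> 3" for n
  proof -
    \<comment> \<open>Three successors keep even \<open>n - 2\<close> positive, where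
      \<open>fib\<close> applies.\<close>
    obtain m where "n = Suc (Suc (Suc m))"
      using n by (metis add_Suc le_Suc_ex numeral_3_eq_3)
    then show ?thesis
      by (simp add: fib)
  qed
  moreover have "a 1 = 1" "a 2 = 1"
    using fib[of 1] fib[of 2] by (simp_all add: numeral_2_eq_2)
  ultimately show ?thesis
    using fib by blast
qed

end
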